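(* For every $n\ge1$, the integer $\tilde k_{2n}(0)$ equals the number of pairs $(\sigma,r)$ where $\sigma\in\mathcal{M}^c(2n)$ and $r$ is an acyclic orientation of the crossing graph $G(\sigma)$ whose unique source is the arch of $\sigma$ containing $1$.
   Context: The integers $\tilde k_{2n}(0)$, $n\ge1$, are defined by $-\log\big(\sum_{n\ge0}(-1)^nC_n\frac{z^{2n}}{(2n)!}\big)=\sum_{n\ge1}\tilde k_{2n}(0)\frac{z^{2n}}{(2n)!}$, where $C_n=\frac{1}{n+1}\binom{2n}{n}$ is the Catalan number (equivalently, $\tilde k_{2n}(0)=(-1)^{n-1}k_{2n}$ where $k_n$ are the classical cumulants of the semicircular law on $[-2,2]$). $\mathcal{M}^c(2n)$ is the set of connected matchings of $\{1,\dots,2n\}$: set partitions into blocks (arches) of size $2$ such that no proper subinterval of $\{1,\dots,2n\}$ is a union of arches. The crossing graph $G(\sigma)$ has the arches as vertices and an edge between $\{i,j\}$ and $\{k,\ell\}$ iff $i<k<j<\ell$. A source of an orientation is a vertex with no incoming arcs. *)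

theory Defs
  imports
    "HOL-Computational_Algebra.Formal_Power_Series"
    "HOL-Library.Disjoint_Sets"
begin

definition catalan :: "nat \<Rightarrow> nat" where
  "catalan n = (2 * n choose n) div (n + 1)"

lemma of_nat_catalan:
  "(of_nat (catalan n) :: rat) = 1 / of_nat (n + 1) * of_nat (2 * n choose n)"
proof (cases n)
  case 0
  then show ?thesis by (simp add: catalan_def)
next
  case (Suc m)
  have "Suc n * (2 * n choose Suc n) = n * (2 * n choose n)"
    using Suc_times_binomial_add [of n m] Suc by (simp add: mult_2)
  then have "n + 1 dvd n * (2 * n choose n)"
    by (metis Suc_eq_plus1 dvd_triv_left)
  moreover have "coprime (n + 1) n" by simp
  ultimately have "n + 1 dvd (2 * n choose n)"
    using coprime_dvd_mult_right_iff by blast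
  then obtain k where "2 * n choose n = (n + 1) * k" by (auto elim: dvdE)
  moreover from this have "catalan n = k"
    by (simp add: catalan_def del: mult_Suc)
  moreover have "(of_nat (n + 1) :: rat) \<noteq> 0"
    unfolding of_nat_eq_0_iff by simp
  ultimately show ?thesis
    by (simp only: of_nat_mult) (simp del: of_nat_add of_nat_Suc)
qed

definition catalan_fps :: "rat fps" where
  "catalan_fps = Abs_fps (\<lambda>m. if even m
     then (-1) ^ (m div 2) * of_nat (catalan (m div 2)) / fact m else 0)"

text \<open>The constant coefficient of \<^term>\<open>catalan_fps\<close> is 1, and \<^term>\<open>fps_ln 1\<close> is the series of
  \<open>log (1 + z)\<close>, so \<^term>\<open>fps_ln 1 oo (catalan_fps - 1)\<close> is \<open>log\<close> of \<^term>\<open>catalan_fps\<close>.\<close>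

definition ktilde0 :: "nat \<Rightarrow> rat" where
  "ktilde0 m = fact m * fps_nth (- (fps_ln 1 oo (catalan_fps - 1))) m"

lemma catalan_fps_nth_0: "fps_nth catalan_fps 0 = 1"
  by (simp add: catalan_fps_def catalan_def)

lemma even_fps_power_nth_odd:
  fixes G :: "'a::comm_ring_1 fps"
  assumes "\<And>m. odd m \<Longrightarrow> fps_nth G m = 0" and "odd m"
  shows "fps_nth (G ^ i) m = 0"
  using assms(2)
proof (induction i arbitrary: m)
  case 0
  then show ?case by (cases m) auto
next
  case (Suc i)
  have "fps_nth G j * fps_nth (G ^ i) (m - j) = 0" if "j \<le> m" for j
  proof (cases "odd j")
    case True
    then show ?thesis by (simp add: assms(1))
  next
    case False
    then have "odd (m - j)" using Suc.prems that by simp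
    then show ?thesis using Suc.IH by simp
  qed
  then show ?case by (simp add: fps_mult_nth)
qed

lemma ktilde0_odd: "ktilde0 m = 0" if "odd m"
proof -
  have "fps_nth (catalan_fps - 1) j = 0" if "odd j" for j
    using that by (cases j) (auto simp: catalan_fps_def)
  then show ?thesis
    using that by (simp add: ktilde0_def fps_compose_nth even_fps_power_nth_odd)
qed

lemma ktilde0_generating_function:
  "- (fps_ln 1 oo (catalan_fps - 1)) =
     Abs_fps (\<lambda>m. if even m \<and> m \<ge> 2 then ktilde0 m / fact m else 0)"
proof (rule fps_ext)
  fix m :: nat
  have "ktilde0 0 = 0" by (simp add: ktilde0_def)
  moreover have "m = 0 \<or> odd m \<or> (even m \<and> m \<ge> 2)" by presburger
  moreover have "fps_nth (- (fps_ln 1 oo (catalan_fps - 1))) m = ktilde0 m / fact m"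
    by (simp add: ktilde0_def)
  ultimately show "fps_nth (- (fps_ln 1 oo (catalan_fps - 1))) m =
     fps_nth (Abs_fps (\<lambda>m. if even m \<and> m \<ge> 2 then ktilde0 m / fact m else 0)) m"
    by (auto simp: ktilde0_odd)
qed

definition is_matching :: "nat \<Rightarrow> nat set set \<Rightarrow> bool" where
  "is_matching N \<sigma> \<longleftrightarrow> partition_on {1..N} \<sigma> \<and> (\<forall>A\<in>\<sigma>. card A = 2)"

text \<open>Intervals are nonempty here: the empty interval is the union of no arches.\<close>

definition connected_matchings :: "nat \<Rightarrow> nat set set set" where
  "connected_matchings N = {\<sigma>. is_matching N \<sigma> \<and>
     \<not> (\<exists>a b. a \<le> b \<and> {a..b} \<subset> {1..N} \<and> (\<exists>S\<subseteq>\<sigma>. \<Union>S = {a..b}))}"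

definition crossing_edges :: "nat set set \<Rightarrow> nat set set set" where
  "crossing_edges \<sigma> = {{A, B} | A B. A \<in> \<sigma> \<and> B \<in> \<sigma> \<and>
     (\<exists>i j k l. A = {i, j} \<and> B = {k, l} \<and> i < k \<and> k < j \<and> j < l)}"

text \<open>An orientation of the loopless graph with edge set \<open>E\<close> is given by its set of arcs;
  \<open>(u, v)\<close> is the arc from \<open>u\<close> to \<open>v\<close>.\<close>

definition is_orientation :: "'v set set \<Rightarrow> ('v \<times> 'v) set \<Rightarrow> bool" where
  "is_orientation E r \<longleftrightarrow> (\<forall>(u, v)\<in>r. {u, v} \<in> E) \<and>
     (\<forall>u v. {u, v} \<in> E \<longrightarrow> ((u, v) \<in> r \<longleftrightarrow> (v, u) \<notin> r))"

definition sources :: "'v set \<Rightarrow> ('v \<times> 'v) set \<Rightarrow> 'v set" where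
  "sources V r = {v \<in> V. \<forall>u. (u, v) \<notin> r}"

end

theory Submission
  imports Defs
begin

text \<open>Write \<open>F\<close> for \<^term>\<open>catalan_fps\<close> and \<open>K = - log F\<close>. The equation \<open>K' F = - F'\<close> is a
  recurrence that determines the coefficients of \<open>K\<close>. Let \<open>R T\<close> count the pairs of a matching
  of a finite set \<open>T\<close> of naturals and an acyclic orientation of its crossing graph whose unique
  source is the arch of a fixed \<open>a \<in> T\<close>, and let \<open>w T\<close> be the sum over the noncrossing matchings
  of \<open>T\<close> of \<open>-1\<close> to the number of arches. Then the sum of \<open>R T * w (S - T)\<close> over all \<open>T \<subseteq> S\<close>
  containing \<open>a\<close> is \<open>- w S\<close>: after gluing the noncrossing matching of \<open>S - T\<close> back as a set of
  sinks, everything cancels except the noncrossing matchings of \<open>S\<close>. Since \<open>w S\<close> is a signed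
  Catalan number depending only on the size of \<open>S\<close>, this is the recurrence for the coefficients
  of \<open>K\<close>. A matching admitting an orientation with a unique source is automatically connected.\<close>

subsection \<open>Acyclic orientations with a unique source\<close>

definition indep :: "('v \<Rightarrow> 'v \<Rightarrow> bool) \<Rightarrow> 'v set \<Rightarrow> bool" where
  "indep X V \<longleftrightarrow> (\<forall>u\<in>V. \<forall>v\<in>V. \<not> X u v)"

text \<open>An adjacency relation in place of an edge set makes vertex deletion a mere change of
  \<open>V\<close>. A loop at a vertex of \<open>V\<close> would leave no orientation at
  all.\<close>

definition acyclic_orientations :: "('v \<Rightarrow> 'v \<Rightarrow> bool) \<Rightarrow> 'v set \<Rightarrow> ('v \<times> 'v) set set" where
  "acyclic_orientations X V = {r. r \<subseteq> {(u, v). u \<in> V \<and> v \<in> V \<and> X u v} \<and>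
     (\<forall>u\<in>V. \<forall>v\<in>V. X u v \<longrightarrow> ((u, v) \<in> r \<longleftrightarrow> (v, u) \<notin> r)) \<and> acyclic r}"

lemma acyclic_orientations_subset:
  "r \<in> acyclic_orientations X V \<Longrightarrow> r \<subseteq> V \<times> V"
  by (auto simp: acyclic_orientations_def)

lemma acyclic_orientations_arc:
  "r \<in> acyclic_orientations X V \<Longrightarrow> (u, v) \<in> r \<Longrightarrow> u \<in> V \<and> v \<in> V \<and> X u v \<and> (v, u) \<notin> r"
  unfolding acyclic_orientations_def by blast

lemma acyclic_orientations_total:
  "r \<in> acyclic_orientations X V \<Longrightarrow> u \<in> V \<Longrightarrow> v \<in> V \<Longrightarrow> X u v \<Longrightarrow> (u, v) \<in> r \<or> (v, u) \<in> r"
  unfolding acyclic_orientations_def by blast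

lemma acyclic_orientations_finite_arcs:
  assumes "finite V" "r \<in> acyclic_orientations X V" shows "finite r"
  by (rule finite_subset[OF acyclic_orientations_subset[OF assms(2)]]) (use assms in simp)

lemma acyclic_orientations_wf:
  assumes "finite V" "r \<in> acyclic_orientations X V" shows "wf r" "wf (r\<inverse>)"
  using acyclic_orientations_finite_arcs[OF assms] assms(2)
  by (auto intro!: finite_acyclic_wf finite_acyclic_wf_converse simp: acyclic_orientations_def)

lemma finite_acyclic_orientations [intro]:
  assumes "finite V" shows "finite (acyclic_orientations X V)"
proof (rule finite_subset)
  show "acyclic_orientations X V \<subseteq> Pow (V \<times> V)"
    by (auto simp: acyclic_orientations_def)
qed (use assms in auto)

lemma acyclic_orientations_indep:
  assumes "indep X V" shows "acyclic_orientations X V = {{}}"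
  using assms by (auto simp: acyclic_orientations_def indep_def acyclic_def)

text \<open>No arc leaves \<open>T\<close>, so a path ending in \<open>W\<close> uses arcs of
  \<open>r\<close> only. Every path starts in \<open>W\<close>, hence a cycle would already be a
  cycle of \<open>r\<close>.\<close>

lemma acyclic_Un_sinks:
  assumes "acyclic r" "r \<subseteq> W \<times> W" "s \<subseteq> W \<times> T" "W \<inter> T = {}"
  shows "acyclic (r \<union> s)"
proof -
  have "y \<in> W \<longrightarrow> (x, y) \<in> r\<^sup>+" if "(x, y) \<in> (r \<union> s)\<^sup>+" for x y
    using that
  proof (induction rule: trancl_induct)
    case (base y)
    then show ?case using assms by auto
  next
    case (step y z)
    then show ?case using assms by (blast intro: trancl_into_trancl)
  qed
  moreover have "x \<in> W" if "(x, y) \<in> (r \<union> s)\<^sup>+" for x y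
    using that assms by (induction rule: converse_trancl_induct) auto
  ultimately show ?thesis using \<open>acyclic r\<close> unfolding acyclic_def by blast
qed

text \<open>Adding or removing a fixed \<open>x\<close> in \<open>B - A\<close> is an involution of
  the interval that reverses the sign.\<close>

lemma sum_minus_one_power_interval:
  assumes "finite B" "A \<subset> B"
  shows "(\<Sum>C | A \<subseteq> C \<and> C \<subseteq> B. (-1) ^ card C :: rat) = 0"
proof -
  obtain x where x: "x \<in> B" "x \<notin> A" using assms by blast
  define t where "t C = (if x \<in> C then C - {x} else insert x C)" for C
  let ?I = "{C. A \<subseteq> C \<and> C \<subseteq> B}"
  have c: "(-1) ^ card (t C) = - ((-1) ^ card C :: rat)" if "C \<in> ?I" for C
  proof -
    have "finite C" using that assms finite_subset by auto
    show ?thesis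
    proof (cases "x \<in> C")
      case True
      then have "card C = Suc (card (t C))" using card.remove[OF \<open>finite C\<close> True] by (simp add: t_def)
      then show ?thesis by simp
    next
      case False
      then show ?thesis using \<open>finite C\<close> by (simp add: t_def)
    qed
  qed
  have "(\<Sum>C\<in>?I. (-1) ^ card C :: rat) = (\<Sum>C\<in>?I. (-1) ^ card (t C))"
  proof (rule sum.reindex_bij_witness[of _ t t])
    fix C assume C: "C \<in> ?I"
    show tt: "t (t C) = C" by (auto simp: t_def)
    then show "(-1) ^ card (t (t C)) = ((-1) ^ card C :: rat)" by simp
    show "t C \<in> ?I" using C x by (auto simp: t_def)
    then show "t C \<in> ?I" .
    show "t (t C) = C" by (rule tt)
  qed
  also have "\<dots> = - (\<Sum>C\<in>?I. (-1) ^ card C)"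
    by (simp add: c sum_negf)
  finally show ?thesis by simp
qed

text \<open>If there were an edge, a last vertex reachable from the tail of some arc would be a sink
  with an incoming arc: a sink that is no source, and therefore different from
  \<open>a\<close>.\<close>

lemma indep_if_sinks_subset_sources:
  assumes "finite V" "r \<in> acyclic_orientations X V" "a \<in> sources V r"
    and sub: "sources V (r\<inverse>) - {a} \<subseteq> sources V r"
  shows "indep X V"
proof (rule ccontr)
  assume "\<not> indep X V"
  then obtain u v where "(u, v) \<in> r"
    using assms(2) acyclic_orientations_total unfolding indep_def by metis
  then have "v \<in> {t. (u, t) \<in> r\<^sup>+}" by auto
  then obtain t where t: "(u, t) \<in> r\<^sup>+" and max: "\<And>y. (y, t) \<in> r\<inverse> \<Longrightarrow> (u, y) \<notin> r\<^sup>+"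
    by (rule wfE_min[OF acyclic_orientations_wf(2)[OF assms(1,2)]]) blast
  have sink: "(t, y) \<notin> r" for y using max[of y] t by (auto dest: trancl_into_trancl)
  obtain y where y: "(y, t) \<in> r" using t by (meson tranclD2)
  have "t \<in> V" using y assms(2) acyclic_orientations_arc by fast
  then have "t \<in> sources V (r\<inverse>)" using sink by (simp add: sources_def)
  moreover have "t \<notin> sources V r" using y by (auto simp: sources_def)
  ultimately show False using sub assms(3) by auto
qed

text \<open>Glue the deleted independent set \<open>\<tau>\<close> back as a set of sinks: for a fixed acyclic
  orientation of the whole graph, \<open>\<tau>\<close> then ranges over an interval of the Boolean lattice, so the
  signs cancel unless the interval is a single point.\<close>

lemma unique_source_orientations_alternating_sum:
  assumes V: "finite V" "a \<in> V" and X: "symp X"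
  shows "(\<Sum>\<tau> | \<tau> \<subseteq> V - {a} \<and> indep X \<tau>. (-1) ^ card \<tau> *
            of_nat (card {r \<in> acyclic_orientations X (V - \<tau>). sources (V - \<tau>) r = {a}})) =
         (if indep X V then (-1) ^ (card V - 1) else 0 :: rat)"
proof -
  let ?O = "acyclic_orientations X"
  let ?I = "{\<tau>. \<tau> \<subseteq> V - {a} \<and> indep X \<tau>}"
  let ?R = "\<lambda>\<tau>. {r \<in> ?O (V - \<tau>). sources (V - \<tau>) r = {a}}"
  let ?G = "{r \<in> ?O V. a \<in> sources V r}"
  \<comment> \<open>Deleting sinks does not change which of the remaining vertices are sources.
    Hence \<open>\<tau>\<close> may be any set of sinks avoiding \<open>a\<close>, provided that it
    contains every source other than \<open>a\<close>.\<close>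
  let ?J = "\<lambda>r. {\<tau>. sources V r - {a} \<subseteq> \<tau> \<and> \<tau> \<subseteq> sources V (r\<inverse>) - {a}}"
  define glue where "glue r \<tau> = r \<union> {(u, v). u \<in> V - \<tau> \<and> v \<in> \<tau> \<and> X u v}" for r \<tau>
  have sub: "finite \<tau>" if "\<tau> \<in> ?I" for \<tau> using that V finite_subset by auto
  have finI: "finite ?I" using V by (rule_tac finite_subset[of _ "Pow V"]) auto
  have finG: "finite ?G"
    by (rule finite_subset[OF _ finite_acyclic_orientations[OF V(1), of X]]) blast
  have finR: "finite (?R \<tau>)" for \<tau>
    by (rule finite_subset[OF _ finite_acyclic_orientations[of "V - \<tau>" X]]) (use V in auto)
  have finJ: "finite (?J r)" for r using V by (rule_tac finite_subset[of _ "Pow V"]) (auto simp: sources_def)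
  have Xs: "X u v \<Longrightarrow> X v u" for u v using X by (auto dest: sympD)
  have glueG: "glue r \<tau> \<in> ?G" "\<tau> \<in> ?J (glue r \<tau>)"
      "glue r \<tau> \<inter> (V - \<tau>) \<times> (V - \<tau>) = r" if t: "\<tau> \<in> ?I" and r: "r \<in> ?R \<tau>" for \<tau> r
  proof -
    have rO: "r \<in> ?O (V - \<tau>)" and s: "sources (V - \<tau>) r = {a}" using r by auto
    have rsub: "r \<subseteq> (V - \<tau>) \<times> (V - \<tau>)" using acyclic_orientations_subset[OF rO] .
    have ac: "acyclic (glue r \<tau>)" unfolding glue_def
      by (rule acyclic_Un_sinks[where W = "V - \<tau>" and T = \<tau>])
         (use rO rsub in \<open>auto simp: acyclic_orientations_def\<close>)
    have ind: "\<not> X u v" if "u \<in> \<tau>" "v \<in> \<tau>" for u v using t that by (auto simp: indep_def)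
    have tV: "\<tau> \<subseteq> V" "a \<notin> \<tau>" using t by auto
    have tot: "(u, v) \<in> glue r \<tau> \<longleftrightarrow> (v, u) \<notin> glue r \<tau>" if "u \<in> V" "v \<in> V" "X u v" for u v
      using that ind[of u v] Xs[of u v] acyclic_orientations_total[OF rO, of u v]
        acyclic_orientations_arc[OF rO, of u v] acyclic_orientations_arc[OF rO, of v u]
      unfolding glue_def by (cases "u \<in> \<tau>"; cases "v \<in> \<tau>") auto
    have arcs: "u \<in> V \<and> v \<in> V \<and> X u v" if "(u, v) \<in> glue r \<tau>" for u v
      using that tV acyclic_orientations_arc[OF rO] unfolding glue_def by blast
    have O: "glue r \<tau> \<in> ?O V"
    proof -
      have "glue r \<tau> \<subseteq> {(u, v). u \<in> V \<and> v \<in> V \<and> X u v}" using arcs by blast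
      moreover have "\<forall>u\<in>V. \<forall>v\<in>V. X u v \<longrightarrow> ((u, v) \<in> glue r \<tau> \<longleftrightarrow> (v, u) \<notin> glue r \<tau>)"
        using tot by blast
      ultimately show ?thesis
        unfolding acyclic_orientations_def using ac by (intro CollectI conjI)
    qed
    \<comment> \<open>All glued arcs end in \<open>\<tau>\<close>, so outside \<open>\<tau>\<close>
      the sources are those of \<open>r\<close>.\<close>
    have so: "sources V (glue r \<tau>) - \<tau> = {a}"
    proof -
      have "sources V (glue r \<tau>) - \<tau> = sources (V - \<tau>) r"
        by (auto simp: sources_def glue_def)
      then show ?thesis using s by simp
    qed
    show "glue r \<tau> \<in> ?G" using O so by auto
    have "\<tau> \<subseteq> sources V ((glue r \<tau>)\<inverse>)"
      using tV rsub by (auto simp: sources_def glue_def)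
    then show "\<tau> \<in> ?J (glue r \<tau>)" using so tV by auto
    show "glue r \<tau> \<inter> (V - \<tau>) \<times> (V - \<tau>) = r"
      using rsub by (auto simp: glue_def)
  qed
  have cut: "\<tau> \<in> ?I" "r \<inter> (V - \<tau>) \<times> (V - \<tau>) \<in> ?R \<tau>"
      "glue (r \<inter> (V - \<tau>) \<times> (V - \<tau>)) \<tau> = r" if r: "r \<in> ?G" and t: "\<tau> \<in> ?J r" for \<tau> r
  proof -
    have rO: "r \<in> ?O V" and a: "a \<in> sources V r" using r by auto
    have tV: "\<tau> \<subseteq> V" "a \<notin> \<tau>" using t by (auto simp: sources_def)
    have sink: "(u, v) \<notin> r" if "u \<in> \<tau>" for u v using t that by (auto simp: sources_def)
    show "\<tau> \<in> ?I"
      using tV sink acyclic_orientations_total[OF rO] by (auto simp: indep_def) blast+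
    let ?r = "r \<inter> (V - \<tau>) \<times> (V - \<tau>)"
    have "acyclic ?r" using rO by (auto simp: acyclic_orientations_def intro: acyclic_subset)
    then have "?r \<in> ?O (V - \<tau>)" using rO unfolding acyclic_orientations_def by blast
    moreover have "sources (V - \<tau>) ?r = sources V r - \<tau>"
      using sink acyclic_orientations_arc[OF rO] unfolding sources_def by blast
    ultimately show "?r \<in> ?R \<tau>" using t a tV by auto
    show "glue ?r \<tau> = r"
    proof (rule set_eqI, clarify)
      fix u v
      show "(u, v) \<in> glue ?r \<tau> \<longleftrightarrow> (u, v) \<in> r"
        using sink[of u v] sink[of v u] tV acyclic_orientations_arc[OF rO, of u v]
          acyclic_orientations_total[OF rO, of u v] unfolding glue_def by blast
    qed
  qed
  have "(\<Sum>\<tau>\<in>?I. (-1) ^ card \<tau> * of_nat (card (?R \<tau>))) =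
        (\<Sum>\<tau>\<in>?I. \<Sum>r\<in>?R \<tau>. (-1) ^ card \<tau> :: rat)"
    by (simp add: mult.commute)
  also have "\<dots> = (\<Sum>(\<tau>, r)\<in>Sigma ?I ?R. (-1) ^ card \<tau>)"
    by (rule sum.Sigma) (use finI finR in auto)
  \<comment> \<open>Double counting: \<open>glue\<close> and restriction to
    \<open>V - \<tau>\<close> are inverse to each other, so the outer sum may run over orientations
    of the whole graph.\<close>
  also have "\<dots> = (\<Sum>(r, \<tau>)\<in>Sigma ?G ?J. (-1) ^ card \<tau>)"
  proof (rule sum.reindex_bij_witness[of _
        "\<lambda>(r, \<tau>). (\<tau>, r \<inter> (V - \<tau>) \<times> (V - \<tau>))" "\<lambda>(\<tau>, r). (glue r \<tau>, \<tau>)"], goal_cases)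
    case (1 p)
    then show ?case using glueG(3) by (elim SigmaE) (simp only: prod.case)
  next
    case (2 p)
    then show ?case using glueG(1,2) by (elim SigmaE) (simp only: prod.case mem_Sigma_iff simp_thms)
  next
    case (3 p)
    then show ?case using cut(3) by (elim SigmaE) (simp only: prod.case)
  next
    case (4 p)
    then show ?case using cut(1,2) by (elim SigmaE) (simp only: prod.case mem_Sigma_iff simp_thms)
  next
    case (5 p)
    then show ?case by (elim SigmaE) (simp only: prod.case)
  qed
  also have "\<dots> = (\<Sum>r\<in>?G. \<Sum>\<tau>\<in>?J r. (-1) ^ card \<tau>)"
    by (rule sum.Sigma[symmetric]) (use finG finJ in auto)
  also have "\<dots> = (if indep X V then (-1) ^ (card V - 1) else 0)"
  proof (cases "indep X V")
    case True
    \<comment> \<open>Without edges every vertex is both a source and a sink, so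
      \<open>\<tau>\<close> has to be all of \<open>V - {a}\<close>; this explains the exponent
      \<open>card V - 1\<close>.\<close>
    have "?G = {{}}" using acyclic_orientations_indep[OF True] V by (auto simp: sources_def)
    moreover have "?J {} = {V - {a}}" by (auto simp: sources_def)
    ultimately show ?thesis using True V by simp
  next
    case False
    \<comment> \<open>The interval is either empty or, by
      \<open>indep_if_sinks_subset_sources\<close>, has distinct endpoints, so its signed sum
      vanishes.\<close>
    have "(\<Sum>\<tau>\<in>?J r. (-1) ^ card \<tau>) = (0::rat)" if r: "r \<in> ?G" for r
    proof (cases "sources V r - {a} \<subseteq> sources V (r\<inverse>) - {a}")
      case True
      moreover have "\<not> sources V (r\<inverse>) - {a} \<subseteq> sources V r - {a}"
        using indep_if_sinks_subset_sources[OF V(1)] r False by blast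
      ultimately show ?thesis
        by (intro sum_minus_one_power_interval)
           (use V in \<open>auto simp: sources_def intro: finite_subset[of _ V]\<close>)
    next
      case False
      then have "?J r = {}" by blast
      then show ?thesis by (simp only: sum.empty)
    qed
    then show ?thesis using False by simp
  qed
  finally show ?thesis .
qed

text \<open>No arc enters \<open>W\<close> from outside, so a vertex of \<open>W\<close> without
  predecessors in \<open>W\<close> is a source of the whole graph.\<close>

lemma unique_source_meets_separated_set:
  assumes V: "finite V" "r \<in> acyclic_orientations X V" and a: "sources V r = {a}"
    and W: "W \<subseteq> V" "W \<noteq> {}" and sep: "\<And>u v. u \<in> V - W \<Longrightarrow> v \<in> W \<Longrightarrow> \<not> X u v"
  shows "a \<in> W"
proof -
  obtain w where w: "w \<in> W" and min: "\<And>y. (y, w) \<in> r \<Longrightarrow> y \<notin> W"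
    by (metis W(2) acyclic_orientations_wf(1)[OF V] ex_in_conv wfE_min)
  have "(y, w) \<notin> r" for y
    using min[of y] sep[of y w] w acyclic_orientations_arc[OF V(2), of y w] by blast
  then have "w \<in> sources V r" using w W by (auto simp: sources_def)
  then show ?thesis using a w by auto
qed

subsection \<open>Signed Catalan numbers\<close>

text \<open>This two-term recurrence is, coefficient by coefficient, the differential equation for
  \<open>s\<close> in the next proof.\<close>

lemma catalan_Suc: "(of_nat n + 2) * (of_nat (catalan (Suc n)) :: rat) = (4 * of_nat n + 2) * of_nat (catalan n)"
proof -
  have "(n + 1) * (2 * Suc n choose Suc n) = 2 * (2 * n + 1) * (2 * n choose n)"
  proof -
    have "Suc n * (Suc (Suc (2 * n)) choose Suc n) = Suc n * (2 * (Suc (2 * n) choose n))"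
      using Suc_times_binomial_eq[of "Suc (2 * n)" n] by (simp add: algebra_simps del: binomial_Suc_Suc)
    then have "(Suc (Suc (2 * n)) choose Suc n) = 2 * (Suc (2 * n) choose n)"
      by (simp only: mult_cancel1) simp
    moreover have "(Suc (2 * n) choose n) = (Suc (2 * n) choose Suc n)"
      using binomial_symmetric[of n "Suc (2 * n)"] by simp
    moreover have "Suc n * (Suc (2 * n) choose Suc n) = Suc (2 * n) * (2 * n choose n)"
      using Suc_times_binomial_eq[of "2 * n" n] by (simp del: binomial_Suc_Suc)
    ultimately show ?thesis by (simp del: binomial_Suc_Suc)
  qed
  then have b: "(of_nat n + 1) * (of_nat (2 * Suc n choose Suc n) :: rat) = 2 * (2 * of_nat n + 1) * of_nat (2 * n choose n)"
    by (metis (mono_tags, lifting) of_nat_1 of_nat_add of_nat_mult of_nat_numeral)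
  have b1: "of_nat (2 * Suc n choose Suc n) = (of_nat n + 2) * (of_nat (catalan (Suc n)) :: rat)"
    by (simp add: of_nat_catalan field_simps del: mult_Suc_right binomial_Suc_Suc)
  have b0: "of_nat (2 * n choose n) = (of_nat n + 1) * (of_nat (catalan n) :: rat)"
    by (simp add: of_nat_catalan field_simps)
  have "(of_nat n + 1) * ((of_nat n + 2) * (of_nat (catalan (Suc n)) :: rat)) =
      (of_nat n + 1) * ((4 * of_nat n + 2) * of_nat (catalan n))"
    using b unfolding b1 b0 by (simp add: algebra_simps)
  moreover have "(of_nat n + 1 :: rat) \<noteq> 0" by (metis of_nat_Suc of_nat_neq_0 add.commute)
  ultimately show ?thesis by (simp only: mult_cancel_left simp_thms)
qed

text \<open>The series \<open>s = 1 - 2 X c\<close>, with \<open>c\<close> the Catalan generating function, satisfies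
  \<open>(1 - 4 X) s' = - 2 s\<close>, so that \<open>s\<^sup>2 = 1 - 4 X\<close>.\<close>

lemma catalan_convolution:
  "(\<Sum>i\<le>n. of_nat (catalan i) * of_nat (catalan (n - i))) = (of_nat (catalan (Suc n)) :: rat)"
proof -
  define c :: "rat fps" where "c = Abs_fps (\<lambda>n. of_nat (catalan n))"
  define s where "s = 1 - 2 * fps_X * c"
  define q where "q = s * s"
  have c0: "catalan 0 = 1" by (simp add: catalan_def)
  have num: "(2 :: rat fps) = fps_const 2" "(4 :: rat fps) = fps_const 4"
    by (simp_all add: numeral_fps_const)
  have s_nth: "fps_nth s (Suc k) = - 2 * of_nat (catalan k)" "fps_nth s 0 = 1" for k
    by (simp_all add: s_def c_def num mult.assoc)
  have nth: "fps_nth ((1 - 4 * fps_X) * f) k = fps_nth f k - 4 * (if k = 0 then 0 else fps_nth f (k - 1))"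
    for f :: "rat fps" and k
    by (simp add: left_diff_distrib num mult.assoc)
  \<comment> \<open>Coefficient 0 amounts to \<open>catalan 0 = 1\<close>, and coefficient
    \<open>Suc j\<close> to \<open>catalan_Suc\<close>.\<close>
  have ode: "(1 - 4 * fps_X) * fps_deriv s = - 2 * s"
  proof (rule fps_ext)
    fix k
    show "fps_nth ((1 - 4 * fps_X) * fps_deriv s) k = fps_nth (- 2 * s) k"
    proof (cases k)
      case 0
      then show ?thesis by (simp only: nth) (simp add: s_nth c0 num)
    next
      case (Suc j)
      have "fps_nth (- 2 * s) k = 4 * of_nat (catalan j)"
        using Suc by (simp add: num s_nth)
      then show ?thesis using catalan_Suc[of j] Suc
        by (simp only: nth) (simp add: s_nth algebra_simps)
    qed
  qed
  have "(1 - 4 * fps_X) * fps_deriv q = 2 * s * ((1 - 4 * fps_X) * fps_deriv s)"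
    by (simp add: q_def algebra_simps)
  also have "\<dots> = - 4 * q" unfolding ode by (simp add: q_def)
  finally have q: "(1 - 4 * fps_X) * fps_deriv q = - 4 * q" .
  \<comment> \<open>The factor \<open>4 * k - 4\<close> vanishes at \<open>k = 1\<close>, which
    kills every coefficient of \<open>q\<close> from degree 2 on.\<close>
  have rec: "of_nat (Suc k) * fps_nth q (Suc k) = (4 * of_nat k - 4) * fps_nth q k" for k
    using arg_cong[OF q, of "\<lambda>f. fps_nth f k"]
    unfolding nth by (cases k) (simp_all add: num algebra_simps)
  have q2: "fps_nth q (Suc (Suc k)) = 0" for k
  proof (induction k)
    case 0
    then show ?case using rec[of "Suc 0"] by simp
  next
    case (Suc k)
    then show ?case using rec[of "Suc (Suc k)"] by (simp del: of_nat_Suc)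
  qed
  \<comment> \<open>In this expansion of the square, the vanishing coefficient of degree
    \<open>n + 2\<close> says that \<open>c = 1 + X c^2\<close> holds in degree
    \<open>n + 1\<close>.\<close>
  have "q = 1 - 4 * fps_X * c + 4 * fps_X * fps_X * (c * c)"
    by (simp add: q_def s_def algebra_simps)
  then have "fps_nth q (Suc (Suc n)) = - 4 * fps_nth c (Suc n) + 4 * fps_nth (c * c) n"
    by (simp add: num mult.assoc)
  then have "fps_nth c (Suc n) = fps_nth (c * c) n" using q2 by simp
  then show ?thesis by (simp add: c_def fps_mult_nth atLeast0AtMost)
qed

text \<open>Indexed by the number of points rather than arches, with value 0 where no matching
  exists. This is \<open>m!\<close> times the coefficient of \<open>z^m\<close> in
  \<open>catalan_fps\<close>.\<close>

definition signed_catalan :: "nat \<Rightarrow> rat" where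
  "signed_catalan m = (if even m then (-1) ^ (m div 2) * of_nat (catalan (m div 2)) else 0)"

lemma catalan_fps_nth: "fps_nth catalan_fps m = signed_catalan m / fact m"
  by (simp add: catalan_fps_def signed_catalan_def)

lemma sum_even_indices:
  fixes g :: "nat \<Rightarrow> 'a::comm_monoid_add"
  assumes "\<And>i. odd i \<Longrightarrow> g i = 0"
  shows "(\<Sum>i\<le>2 * n. g i) = (\<Sum>i\<le>n. g (2 * i))"
proof (induction n)
  case (Suc n)
  then show ?case using assms[of "Suc (2 * n)"] by simp
qed simp

text \<open>For odd \<open>m\<close>, one index in each product is odd. For \<open>m = 2n\<close>,
  the signs in each product combine to \<open>(-1)^n\<close>, whereas \<open>m + 2\<close> points
  belong to \<open>n + 1\<close> arches; this gives the minus sign.\<close>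

lemma signed_catalan_convolution:
  "(\<Sum>i\<le>m. signed_catalan i * signed_catalan (m - i)) = - signed_catalan (m + 2)"
proof (cases "even m")
  case False
  have "signed_catalan i * signed_catalan (m - i) = 0" if "i \<le> m" for i
    using that False by (auto simp: signed_catalan_def)
  then have "(\<Sum>i\<le>m. signed_catalan i * signed_catalan (m - i)) = 0"
    by (intro sum.neutral) simp
  then show ?thesis using False by (simp add: signed_catalan_def)
next
  case True
  then obtain n where m: "m = 2 * n" by auto
  have "(\<Sum>i\<le>m. signed_catalan i * signed_catalan (m - i)) =
      (\<Sum>i\<le>n. signed_catalan (2 * i) * signed_catalan (2 * n - 2 * i))"
    unfolding m by (rule sum_even_indices) (simp add: signed_catalan_def)
  also have "\<dots> = (\<Sum>i\<le>n. (-1) ^ n * (of_nat (catalan i) * of_nat (catalan (n - i))))"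
  proof (rule sum.cong[OF refl])
    fix i assume "i \<in> {..n}"
    then have "i \<le> n" by simp
    then have "(-1 :: rat) ^ i * (-1) ^ (n - i) = (-1) ^ n" by (simp flip: power_add)
    moreover have "2 * n - 2 * i = 2 * (n - i)" by simp
    ultimately show "signed_catalan (2 * i) * signed_catalan (2 * n - 2 * i) =
        (-1) ^ n * (of_nat (catalan i) * of_nat (catalan (n - i)))"
      by (simp add: signed_catalan_def)
  qed
  also have "\<dots> = (-1) ^ n * of_nat (catalan (Suc n))"
    by (simp add: sum_distrib_left[symmetric] catalan_convolution)
  finally show ?thesis by (simp add: signed_catalan_def m)
qed

text \<open>This is the coefficient of \<open>z^m\<close> in \<open>K' F = - F'\<close>, times
  \<open>m!\<close>: products of exponential series turn into binomial convolutions, and derivatives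
  shift the index by one.\<close>

lemma ktilde0_recurrence:
  "(\<Sum>i\<le>m. of_nat (m choose i) * (ktilde0 (Suc i) * signed_catalan (m - i))) = - signed_catalan (Suc m)"
proof -
  define K where "K = - (fps_ln 1 oo (catalan_fps - 1))"
  have K: "fps_nth K i = ktilde0 i / fact i" for i by (simp add: K_def ktilde0_def)
  have F0: "fps_nth (catalan_fps - 1) 0 = 0" by (simp add: catalan_fps_nth_0)
  \<comment> \<open>The derivative of \<open>fps_ln 1\<close> is \<open>1 / (1 + X)\<close>;
    composed with \<open>F - 1\<close> it becomes \<open>1 / F\<close>.\<close>
  have "inverse (1 + fps_X :: rat fps) oo (catalan_fps - 1) = inverse ((1 + fps_X) oo (catalan_fps - 1))"
    by (rule fps_inverse_compose) (simp_all add: catalan_fps_nth_0)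
  also have "(1 + fps_X) oo (catalan_fps - 1) = catalan_fps"
    by (simp add: fps_compose_add_distrib fps_X_fps_compose_startby0[OF F0])
  finally have "fps_deriv K = - (inverse catalan_fps * fps_deriv catalan_fps)"
    unfolding K_def by (simp add: fps_compose_deriv[OF F0] fps_ln_deriv)
  then have ode: "fps_deriv K * catalan_fps = - fps_deriv catalan_fps"
    using inverse_mult_eq_1[of catalan_fps] by (simp add: catalan_fps_nth_0 mult.commute mult.left_commute)
  have "(\<Sum>i\<le>m. of_nat (m choose i) * (ktilde0 (Suc i) * signed_catalan (m - i))) =
      fact m * fps_nth (fps_deriv K * catalan_fps) m"
    unfolding fps_mult_nth atLeast0AtMost sum_distrib_left
  proof (rule sum.cong[OF refl])
    fix i assume "i \<in> {..m}"
    then have b: "(of_nat (m choose i) :: rat) = fact m / (fact i * fact (m - i))"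
      by (simp add: binomial_fact)
    show "of_nat (m choose i) * (ktilde0 (Suc i) * signed_catalan (m - i)) =
        fact m * (fps_nth (fps_deriv K) i * fps_nth catalan_fps (m - i))"
      unfolding b by (simp add: K catalan_fps_nth fact_Suc del: of_nat_Suc)
  qed
  also have "\<dots> = - signed_catalan (Suc m)"
    unfolding ode by (simp add: catalan_fps_nth fact_Suc del: of_nat_Suc)
  finally show ?thesis .
qed

subsection \<open>Noncrossing matchings\<close>

text \<open>Arbitrary point sets are allowed because the counting deletes arches and leaves
  gaps.\<close>

definition matchings :: "nat set \<Rightarrow> nat set set set" where
  "matchings S = {\<sigma>. partition_on S \<sigma> \<and> (\<forall>A\<in>\<sigma>. card A = 2)}"

text \<open>Symmetrised to serve as an adjacency relation; the inequalities themselves force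
  \<open>i < j\<close> and \<open>k < l\<close>.\<close>

definition crosses :: "nat set \<Rightarrow> nat set \<Rightarrow> bool" where
  "crosses A B \<longleftrightarrow> (\<exists>i j k l. A = {i, j} \<and> B = {k, l} \<and>
     (i < k \<and> k < j \<and> j < l \<or> k < i \<and> i < l \<and> l < j))"

definition noncrossing_matchings :: "nat set \<Rightarrow> nat set set set" where
  "noncrossing_matchings S = {\<sigma> \<in> matchings S. indep crosses \<sigma>}"

definition rooted_orientations :: "nat \<Rightarrow> nat set set \<Rightarrow> (nat set \<times> nat set) set set" where
  "rooted_orientations a \<sigma> =
     {r \<in> acyclic_orientations crosses \<sigma>. \<exists>A\<in>\<sigma>. a \<in> A \<and> sources \<sigma> r = {A}}"

lemma symp_crosses: "symp crosses"
  unfolding symp_def crosses_def by metis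

lemma not_crosses_separated: "(\<And>x y. x \<in> A \<Longrightarrow> y \<in> B \<Longrightarrow> x < y) \<Longrightarrow> \<not> crosses A B"
  unfolding crosses_def by (metis insertI1 insertI2 less_asym)

lemma not_crosses_nested: "B \<subseteq> {a<..<b} \<Longrightarrow> \<not> crosses {a, b} B"
  unfolding crosses_def by (auto simp: doubleton_eq_iff)

section \<open>Restriction, union and finiteness of matchings\<close>

lemma matchingsD:
  assumes "\<sigma> \<in> matchings S"
  shows "\<Union>\<sigma> = S" "B \<in> \<sigma> \<Longrightarrow> B \<subseteq> S" "B \<in> \<sigma> \<Longrightarrow> card B = 2" "B \<in> \<sigma> \<Longrightarrow> B \<noteq> {}"
    "B \<in> \<sigma> \<Longrightarrow> C \<in> \<sigma> \<Longrightarrow> x \<in> B \<Longrightarrow> x \<in> C \<Longrightarrow> B = C"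
  using assms unfolding matchings_def partition_on_def disjoint_def by fastforce+

lemma matchingsI:
  assumes "\<Union>\<sigma> = S" "\<And>B. B \<in> \<sigma> \<Longrightarrow> card B = 2"
    "\<And>B C x. B \<in> \<sigma> \<Longrightarrow> C \<in> \<sigma> \<Longrightarrow> x \<in> B \<Longrightarrow> x \<in> C \<Longrightarrow> B = C"
  shows "\<sigma> \<in> matchings S"
proof -
  have "disjoint \<sigma>" using assms(3) unfolding disjoint_def by blast
  moreover have "{} \<notin> \<sigma>" using assms(2)[of "{}"] by auto
  ultimately show ?thesis using assms(1,2) by (simp add: matchings_def partition_on_def)
qed

lemma matchings_subset:
  assumes "\<sigma> \<in> matchings S" "\<tau> \<subseteq> \<sigma>" shows "\<tau> \<in> matchings (\<Union>\<tau>)"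
proof (rule matchingsI)
  show "B = C" if "B \<in> \<tau>" "C \<in> \<tau>" "x \<in> B" "x \<in> C" for B C x
    using matchingsD(5)[OF assms(1) _ _ that(3,4)] that(1,2) assms(2) by auto
qed (use matchingsD(3)[OF assms(1)] assms(2) in auto)

lemma Union_matching_Diff:
  assumes "\<sigma> \<in> matchings S" "\<tau> \<subseteq> \<sigma>" shows "\<Union>(\<sigma> - \<tau>) = S - \<Union>\<tau>"
proof -
  have "x \<notin> C" if "B \<in> \<sigma> - \<tau>" "x \<in> B" "C \<in> \<tau>" for x B C
    using matchingsD(5)[OF assms(1), of B C x] that assms(2) by auto
  then show ?thesis using matchingsD(1)[OF assms(1)] assms(2) by blast
qed

lemma matchings_Un:
  assumes "\<sigma> \<in> matchings S" "\<tau> \<in> matchings T" "S \<inter> T = {}"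
  shows "\<sigma> \<union> \<tau> \<in> matchings (S \<union> T)"
proof (rule matchingsI)
  show "B = C" if "B \<in> \<sigma> \<union> \<tau>" "C \<in> \<sigma> \<union> \<tau>" "x \<in> B" "x \<in> C" for B C x
    using that assms(3) matchingsD(2,5)[OF assms(1)] matchingsD(2,5)[OF assms(2)] by blast
qed (use matchingsD(1,3)[OF assms(1)] matchingsD(1,3)[OF assms(2)] in auto)

lemma matchings_disjoint:
  assumes "\<sigma> \<in> matchings S" "\<tau> \<in> matchings T" "S \<inter> T = {}"
  shows "\<sigma> \<inter> \<tau> = {}"
  using assms(3) matchingsD(2,4)[OF assms(1)] matchingsD(2)[OF assms(2)] by blast

lemma matchings_pair: "a \<noteq> b \<Longrightarrow> {{a, b}} \<in> matchings {a, b}"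
  by (rule matchingsI) auto

lemma matchings_empty: "matchings {} = {{}}"
  by (auto simp: matchings_def partition_on_empty)

lemma finite_matchings [simp]: "finite S \<Longrightarrow> finite (matchings S)"
  by (rule finite_subset[of _ "Pow (Pow S)"]) (use matchingsD(2) in blast, simp)

lemma finite_matching: "finite S \<Longrightarrow> \<sigma> \<in> matchings S \<Longrightarrow> finite \<sigma>"
  by (rule finite_subset[of _ "Pow S"]) (use matchingsD(2) in blast, simp)

lemma finite_noncrossing_matchings [simp]: "finite S \<Longrightarrow> finite (noncrossing_matchings S)"
  by (rule finite_subset[of _ "matchings S"]) (auto simp: noncrossing_matchings_def)

lemma matching_mate_unique:
  assumes "\<sigma> \<in> matchings S" "a \<in> S" shows "\<exists>!b. {a, b} \<in> \<sigma>"
proof -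
  obtain B where B: "B \<in> \<sigma>" "a \<in> B" using assms matchingsD(1) by blast
  then obtain b where "B = {a, b}"
    using matchingsD(3)[OF assms(1), of B] by (auto simp: card_2_iff)
  with B have "{a, b} \<in> \<sigma>" by simp
  then show ?thesis
    using matchingsD(5)[OF assms(1)] by (intro ex1I) (assumption, metis doubleton_eq_iff insertI1)
qed

definition mate :: "nat \<Rightarrow> nat set set \<Rightarrow> nat" where
  "mate a \<sigma> = (THE b. {a, b} \<in> \<sigma>)"

lemma mate_in: "\<sigma> \<in> matchings S \<Longrightarrow> a \<in> S \<Longrightarrow> {a, mate a \<sigma>} \<in> \<sigma>"
  unfolding mate_def by (rule theI') (rule matching_mate_unique)

lemma mate_eq: "\<sigma> \<in> matchings S \<Longrightarrow> {a, b} \<in> \<sigma> \<Longrightarrow> mate a \<sigma> = b"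
  using matching_mate_unique[of \<sigma> S a] mate_in[of \<sigma> S a] matchingsD(2)[of \<sigma> S "{a, b}"] by auto

section \<open>Signed count of noncrossing matchings\<close>

definition signed_noncrossing :: "nat set \<Rightarrow> rat" where
  "signed_noncrossing S = (\<Sum>\<tau>\<in>noncrossing_matchings S. (-1) ^ card \<tau>)"

text \<open>In a noncrossing matching no arch straddles the partner \<open>j\<close> of the smallest
  point \<open>a\<close>, so the other arches form two freely chosen noncrossing matchings, one
  below and one above \<open>j\<close>. The arch \<open>{a, j}\<close> contributes the minus
  sign.\<close>

lemma signed_noncrossing_recurrence:
  assumes S: "finite S" "a \<in> S" and min: "\<And>x. x \<in> S \<Longrightarrow> a \<le> x"
  defines "L j \<equiv> {x \<in> S - {a}. x < j}" and "U j \<equiv> {x \<in> S. j < x}"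
  shows "signed_noncrossing S =
    - (\<Sum>j\<in>S - {a}. signed_noncrossing (L j) * signed_noncrossing (U j))"
proof -
  let ?N = noncrossing_matchings
  have finL: "finite (L j)" "finite (U j)" for j using S by (auto simp: L_def U_def)
  define glue where "glue j \<alpha> \<beta> = insert {a, j} (\<alpha> \<union> \<beta>)" for j and \<alpha> \<beta> :: "nat set set"
  define lo where "lo \<tau> = {B \<in> \<tau>. B \<subseteq> L (mate a \<tau>)}" for \<tau>
  define up where "up \<tau> = {B \<in> \<tau>. B \<subseteq> U (mate a \<tau>)}" for \<tau>
  have glue: "glue j \<alpha> \<beta> \<in> ?N S" "mate a (glue j \<alpha> \<beta>) = j" "lo (glue j \<alpha> \<beta>) = \<alpha>"
      "up (glue j \<alpha> \<beta>) = \<beta>" "card (glue j \<alpha> \<beta>) = Suc (card \<alpha> + card \<beta>)"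
    if j: "j \<in> S - {a}" and \<alpha>: "\<alpha> \<in> ?N (L j)" and \<beta>: "\<beta> \<in> ?N (U j)" for j \<alpha> \<beta>
  proof -
    have aj: "a < j" using j min[of j] by auto
    have m: "\<alpha> \<in> matchings (L j)" "\<beta> \<in> matchings (U j)"
      using \<alpha> \<beta> by (auto simp: noncrossing_matchings_def)
    have LU: "L j \<inter> U j = {}" "(L j \<union> U j) \<inter> {a, j} = {}" "{a, j} \<union> (L j \<union> U j) = S"
      using j aj S min by (auto simp: L_def U_def)
    have mm: "\<alpha> \<union> \<beta> \<in> matchings (L j \<union> U j)" using matchings_Un[OF m LU(1)] .
    have "{{a, j}} \<union> (\<alpha> \<union> \<beta>) \<in> matchings S"
      using matchings_Un[OF matchings_pair mm] aj LU(2,3) by (auto simp: Int_commute)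
    then have M: "glue j \<alpha> \<beta> \<in> matchings S" by (simp add: glue_def)
    have bL: "B \<subseteq> L j" "B \<noteq> {}" if "B \<in> \<alpha>" for B using that matchingsD[OF m(1)] by auto
    have bU: "B \<subseteq> U j" "B \<noteq> {}" if "B \<in> \<beta>" for B using that matchingsD[OF m(2)] by auto
    have nc: "\<not> crosses B C" "\<not> crosses C B" if "B \<in> \<alpha>" "C \<in> \<beta>" for B C
    proof -
      have "x < y" if "x \<in> B" "y \<in> C" for x y
        using that bL(1)[OF \<open>B \<in> \<alpha>\<close>] bU(1)[OF \<open>C \<in> \<beta>\<close>] by (force simp: L_def U_def)
      then show "\<not> crosses B C" by (rule not_crosses_separated)
      then show "\<not> crosses C B" using symp_crosses by (auto dest: sympD)
    qed
    have nd: "\<not> crosses {a, j} B" "\<not> crosses B {a, j}" if "B \<in> \<alpha> \<union> \<beta>" for B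
    proof -
      show "\<not> crosses {a, j} B"
      proof (cases "B \<in> \<alpha>")
        case True
        then have "B \<subseteq> {a<..<j}" using bL(1) min by (force simp: L_def)
        then show ?thesis by (rule not_crosses_nested)
      next
        case False
        then have "B \<subseteq> U j" using that bU by auto
        then show ?thesis using aj by (intro not_crosses_separated) (force simp: U_def)
      qed
      then show "\<not> crosses B {a, j}" using symp_crosses by (auto dest: sympD)
    qed
    have "\<not> crosses {a, j} {a, j}"
      by (auto simp: crosses_def doubleton_eq_iff)
    then have "indep crosses (glue j \<alpha> \<beta>)"
      using \<alpha> \<beta> nc nd unfolding noncrossing_matchings_def indep_def glue_def by blast
    then show "glue j \<alpha> \<beta> \<in> ?N S" using M by (simp add: noncrossing_matchings_def)
    show mate: "mate a (glue j \<alpha> \<beta>) = j"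
      by (rule mate_eq[OF M]) (simp add: glue_def)
    have "\<not> {a, j} \<subseteq> L j" "\<not> {a, j} \<subseteq> U j" by (auto simp: L_def U_def)
    then show "lo (glue j \<alpha> \<beta>) = \<alpha>" "up (glue j \<alpha> \<beta>) = \<beta>"
      unfolding lo_def up_def mate using bL bU LU(1) unfolding glue_def by blast+
    have "{a, j} \<notin> \<alpha> \<union> \<beta>" using bL bU LU(2) by blast
    moreover have "card (\<alpha> \<union> \<beta>) = card \<alpha> + card \<beta>"
      using matchings_disjoint[OF m LU(1)] finite_matching[OF finL(1) m(1)]
        finite_matching[OF finL(2) m(2)] by (rule_tac card_Un_disjoint)
    ultimately show "card (glue j \<alpha> \<beta>) = Suc (card \<alpha> + card \<beta>)"
      using finite_matching[OF finL(1) m(1)] finite_matching[OF finL(2) m(2)]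
      by (simp add: glue_def)
  qed
  have split: "mate a \<tau> \<in> S - {a}" "lo \<tau> \<in> ?N (L (mate a \<tau>))" "up \<tau> \<in> ?N (U (mate a \<tau>))"
      "glue (mate a \<tau>) (lo \<tau>) (up \<tau>) = \<tau>" if \<tau>: "\<tau> \<in> ?N S" for \<tau>
  proof -
    define j where "j = mate a \<tau>"
    have M: "\<tau> \<in> matchings S" and ind: "indep crosses \<tau>"
      using \<tau> by (auto simp: noncrossing_matchings_def)
    have aj: "{a, j} \<in> \<tau>" unfolding j_def by (rule mate_in[OF M S(2)])
    then show j: "mate a \<tau> \<in> S - {a}"
      using matchingsD(2,3)[OF M aj] unfolding j_def[symmetric] by (auto split: if_splits)
    \<comment> \<open>An arch from below \<open>j\<close> to above \<open>j\<close> would cross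
      \<open>{a, j}\<close>, because \<open>a\<close> is the smallest point.\<close>
    have blk: "B \<subseteq> L j \<or> B \<subseteq> U j" if B: "B \<in> \<tau>" "B \<noteq> {a, j}" for B
    proof -
      have ni: "a \<notin> B" "j \<notin> B" using matchingsD(5)[OF M B(1) aj] B(2) by auto
      obtain k l where kl: "B = {k, l}" "k < l"
        using matchingsD(3)[OF M B(1)] by (metis card_2_iff insert_commute linorder_neqE_nat)
      have "k \<in> S" "l \<in> S" using matchingsD(2)[OF M B(1)] kl by auto
      moreover have "a < k" "a < l" using min[of k] min[of l] \<open>k \<in> S\<close> \<open>l \<in> S\<close> ni kl
        by (auto simp: order_less_le)
      moreover have "\<not> (k < j \<and> j < l)"
        using ind aj B(1) kl \<open>a < k\<close> unfolding indep_def crosses_def by blast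
      ultimately show ?thesis using ni kl by (auto simp: L_def U_def)
    qed
    have eq: "glue j (lo \<tau>) (up \<tau>) = \<tau>"
      using aj blk unfolding glue_def lo_def up_def j_def[symmetric] by auto
    then show "glue (mate a \<tau>) (lo \<tau>) (up \<tau>) = \<tau>" by (simp add: j_def)
    have sub: "lo \<tau> \<subseteq> \<tau>" "up \<tau> \<subseteq> \<tau>" by (auto simp: lo_def up_def)
    have LU: "L j \<inter> U j = {}" "L j \<inter> {a, j} = {}" "U j \<inter> {a, j} = {}"
      using j min unfolding j_def[symmetric] by (auto simp: L_def U_def dest: leD)
    have S_eq: "S = {a, j} \<union> \<Union>(lo \<tau>) \<union> \<Union>(up \<tau>)"
      using matchingsD(1)[OF M] eq unfolding glue_def by auto
    have "\<Union>(lo \<tau>) \<subseteq> L j" "\<Union>(up \<tau>) \<subseteq> U j" by (auto simp: lo_def up_def j_def)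
    moreover have "L j \<subseteq> S" "U j \<subseteq> S" by (auto simp: L_def U_def)
    \<comment> \<open>The two unions lie in disjoint parts of \<open>S - {a, j}\<close> and together
      exhaust it, so each fills its part.\<close>
    ultimately have "\<Union>(lo \<tau>) = L j" "\<Union>(up \<tau>) = U j"
      using LU S_eq by blast+
    moreover have "indep crosses (lo \<tau>)" "indep crosses (up \<tau>)"
      using ind sub by (auto simp: indep_def)
    ultimately show "lo \<tau> \<in> ?N (L (mate a \<tau>))" "up \<tau> \<in> ?N (U (mate a \<tau>))"
      using matchings_subset[OF M sub(1)] matchings_subset[OF M sub(2)]
      by (simp_all add: noncrossing_matchings_def j_def)
  qed
  have "signed_noncrossing S =
      (\<Sum>(j, \<alpha>, \<beta>)\<in>Sigma (S - {a}) (\<lambda>j. ?N (L j) \<times> ?N (U j)). - ((-1) ^ card \<alpha> * (-1) ^ card \<beta>))"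
    unfolding signed_noncrossing_def
  proof (rule sum.reindex_bij_witness[of _ "\<lambda>(j, \<alpha>, \<beta>). glue j \<alpha> \<beta>" "\<lambda>\<tau>. (mate a \<tau>, lo \<tau>, up \<tau>)"], goal_cases)
    case (1 \<tau>)
    then show ?case using split(4) by simp
  next
    case (2 \<tau>)
    then show ?case using split(1-3) by simp
  next
    case (3 p)
    then show ?case using glue(2-4) by (elim SigmaE) (simp only: prod.case)
  next
    case (4 p)
    then show ?case using glue(1) by (elim SigmaE) (simp only: prod.case)
  next
    case (5 \<tau>)
    have "card \<tau> = Suc (card (lo \<tau>) + card (up \<tau>))"
      using glue(5)[OF split(1-3)[OF 5]] split(4)[OF 5] by simp
    then show ?case by (simp add: power_add)
  qed
  also have "\<dots> = (\<Sum>j\<in>S - {a}. \<Sum>(\<alpha>, \<beta>)\<in>?N (L j) \<times> ?N (U j). - ((-1) ^ card \<alpha> * (-1) ^ card \<beta>))"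
    by (rule sum.Sigma[symmetric]) (use S finL in auto)
  also have "\<dots> = (\<Sum>j\<in>S - {a}. - (signed_noncrossing (L j) * signed_noncrossing (U j)))"
    by (simp add: signed_noncrossing_def sum_product sum.cartesian_product sum_negf case_prod_unfold)
  finally show ?thesis by (simp add: sum_negf)
qed

text \<open>The number of smaller elements takes each value below \<open>card A\<close> exactly
  once: a new maximum leaves the earlier ranks alone and takes the next free one.\<close>

lemma sum_rank:
  fixes A :: "'a::linorder set" and g :: "nat \<Rightarrow> 'b::comm_monoid_add"
  assumes "finite A"
  shows "(\<Sum>j\<in>A. g (card {x \<in> A. x < j})) = (\<Sum>i<card A. g i)"
  using assms
proof (induction A rule: finite_linorder_max_induct)
  case (insert b A)
  then have b: "b \<notin> A" by auto
  have "{x \<in> insert b A. x < j} = {x \<in> A. x < j}" if "j \<in> A" for j using insert that by auto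
  moreover have "{x \<in> insert b A. x < b} = A" using insert by auto
  ultimately show ?case using insert b by (simp add: add.commute)
qed simp

text \<open>Strong induction on the size. With \<open>m + 1\<close> points, the two sides of the
  arch through \<open>Min S\<close> have \<open>m - 1\<close> points in total, and the size of the
  lower side runs through all ranks below \<open>m\<close>. So the recurrence becomes the signed
  Catalan convolution.\<close>

lemma signed_noncrossing_eq:
  assumes "finite S" shows "signed_noncrossing S = signed_catalan (card S)"
  using assms
proof (induction "card S" arbitrary: S rule: less_induct)
  case less
  show ?case
  proof (cases "S = {}")
    case True
    then have "noncrossing_matchings S = {{}}"
      by (auto simp: noncrossing_matchings_def matchings_empty indep_def)
    then show ?thesis using True by (simp add: signed_noncrossing_def signed_catalan_def catalan_def)
  next
    case False
    define a where "a = Min S"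
    define L where "L j = {x \<in> S - {a}. x < j}" for j
    define U where "U j = {x \<in> S. j < x}" for j
    have a: "a \<in> S" "\<And>x. x \<in> S \<Longrightarrow> a \<le> x" using less(2) False by (auto simp: a_def)
    define m where "m = card (S - {a})"
    have m: "card S = Suc m" using a less(2) by (simp add: m_def card.remove del: card_Diff_insert)
    have fin: "finite (L j)" "finite (U j)" for j using less(2) by (auto simp: L_def U_def)
    have card: "card (L j) + card (U j) = m - 1" "card (L j) < m" if "j \<in> S - {a}" for j
    proof -
      have "j \<noteq> a" "a \<le> j" using that a by auto
      then have "S - {a} - {j} = L j \<union> U j" "L j \<inter> U j = {}"
        using a(2) that by (auto simp: L_def U_def) (meson leD a(2))
      then have "card (L j) + card (U j) = card (S - {a} - {j})"
        using fin by (simp add: card_Un_disjoint)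
      moreover have "m = Suc (card (S - {a} - {j}))"
        unfolding m_def by (rule card.remove) (use less(2) that in auto)
      ultimately show "card (L j) + card (U j) = m - 1" "card (L j) < m" by auto
    qed
    have "signed_noncrossing S = - (\<Sum>j\<in>S - {a}. signed_noncrossing (L j) * signed_noncrossing (U j))"
      unfolding L_def U_def by (rule signed_noncrossing_recurrence[OF less(2) a])
    also have "(\<Sum>j\<in>S - {a}. signed_noncrossing (L j) * signed_noncrossing (U j)) =
        (\<Sum>j\<in>S - {a}. signed_catalan (card (L j)) * signed_catalan (m - 1 - card (L j)))"
    proof (rule sum.cong[OF refl])
      fix j assume j: "j \<in> S - {a}"
      have "card (U j) = m - 1 - card (L j)" "card (L j) < card S" "card (U j) < card S"
        using card[OF j] m by auto
      then show "signed_noncrossing (L j) * signed_noncrossing (U j) =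
          signed_catalan (card (L j)) * signed_catalan (m - 1 - card (L j))"
        using less(1) fin by metis
    qed
    also have "\<dots> = (\<Sum>i<m. signed_catalan i * signed_catalan (m - 1 - i))"
      unfolding L_def m_def using less(2)
      by (intro sum_rank[of "S - {a}" "\<lambda>i. signed_catalan i * signed_catalan (card (S - {a}) - 1 - i)"]) simp
    also have "\<dots> = - signed_catalan (Suc m)"
    \<comment> \<open>For \<open>m = 0\<close> there is a single point and both sides vanish;
      otherwise the convolution applies at \<open>m - 1\<close>, two below
      \<open>Suc m\<close>.\<close>
    proof (cases m)
      case 0
      then show ?thesis by (simp add: signed_catalan_def)
    next
      case (Suc k)
      then show ?thesis using signed_catalan_convolution[of k] by (simp add: lessThan_Suc_atMost)
    qed
    finally show ?thesis using m by simp
  qed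
qed

subsection \<open>Matchings with a rooted orientation of the crossing graph\<close>

lemma finite_rooted_orientations [simp]: "finite \<sigma> \<Longrightarrow> finite (rooted_orientations a \<sigma>)"
  by (rule finite_subset[of _ "acyclic_orientations crosses \<sigma>"]) (auto simp: rooted_orientations_def)

text \<open>The sum runs over all matchings; the disconnected ones of \<open>{1..N}\<close>
  contribute zero by \<open>matching_connected_if_rooted\<close>.\<close>

definition rooted_count :: "nat \<Rightarrow> nat set \<Rightarrow> rat" where
  "rooted_count a S = (\<Sum>\<sigma>\<in>matchings S. of_nat (card (rooted_orientations a \<sigma>)))"

text \<open>The graph lemma applies to the arches of \<open>\<mu>\<close>, with the arch
  \<open>A\<close> through \<open>a\<close> as distinguished vertex. Avoiding \<open>a\<close> means
  keeping \<open>A\<close>, which then remains the only arch through \<open>a\<close>.\<close>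

lemma alternating_sum_rooted_orientations:
  assumes S: "finite S" "a \<in> S" and \<mu>: "\<mu> \<in> matchings S"
  shows "(\<Sum>\<tau> | \<tau> \<subseteq> \<mu> \<and> a \<notin> \<Union>\<tau> \<and> indep crosses \<tau>.
            of_nat (card (rooted_orientations a (\<mu> - \<tau>))) * (-1) ^ card \<tau> :: rat) =
         (if indep crosses \<mu> then - ((-1) ^ card \<mu>) else 0)"
proof -
  obtain A where A: "A \<in> \<mu>" "a \<in> A" using matchingsD(1)[OF \<mu>] S(2) by blast
  have uniq: "B = A" if "B \<in> \<mu>" "a \<in> B" for B using matchingsD(5)[OF \<mu> that(1) A(1) that(2) A(2)] .
  have fin: "finite \<mu>" using finite_matching[OF S(1) \<mu>] .
  have "(\<Sum>\<tau> | \<tau> \<subseteq> \<mu> \<and> a \<notin> \<Union>\<tau> \<and> indep crosses \<tau>.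
            of_nat (card (rooted_orientations a (\<mu> - \<tau>))) * (-1) ^ card \<tau> :: rat) =
        (\<Sum>\<tau> | \<tau> \<subseteq> \<mu> - {A} \<and> indep crosses \<tau>. (-1) ^ card \<tau> *
          of_nat (card {r \<in> acyclic_orientations crosses (\<mu> - \<tau>). sources (\<mu> - \<tau>) r = {A}}))"
  proof (rule sum.cong)
    show "{\<tau>. \<tau> \<subseteq> \<mu> \<and> a \<notin> \<Union>\<tau> \<and> indep crosses \<tau>} = {\<tau>. \<tau> \<subseteq> \<mu> - {A} \<and> indep crosses \<tau>}"
      using A uniq by blast
    fix \<tau> assume "\<tau> \<in> {\<tau>. \<tau> \<subseteq> \<mu> - {A} \<and> indep crosses \<tau>}"
    then have "A \<in> \<mu> - \<tau>" using A by auto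
    then have "rooted_orientations a (\<mu> - \<tau>) =
        {r \<in> acyclic_orientations crosses (\<mu> - \<tau>). sources (\<mu> - \<tau>) r = {A}}"
      using A uniq unfolding rooted_orientations_def by blast
    then show "of_nat (card (rooted_orientations a (\<mu> - \<tau>))) * (-1) ^ card \<tau> = (-1) ^ card \<tau> *
          (of_nat (card {r \<in> acyclic_orientations crosses (\<mu> - \<tau>). sources (\<mu> - \<tau>) r = {A}}) :: rat)"
      by simp
  qed
  also have "\<dots> = (if indep crosses \<mu> then (-1) ^ (card \<mu> - 1) else 0)"
    by (rule unique_source_orientations_alternating_sum[OF fin A(1) symp_crosses])
  \<comment> \<open>The subtraction is not truncated, since \<open>\<mu>\<close> contains
    \<open>A\<close>.\<close>
  also have "(-1) ^ (card \<mu> - 1) = - ((-1) ^ card \<mu> :: rat)"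
    using card.remove[OF fin A(1)] by simp
  finally show ?thesis by simp
qed

text \<open>A triple \<open>(T, \<sigma>, \<tau>)\<close> amounts to a matching
  \<open>\<mu> = \<sigma> \<union> \<tau>\<close> of \<open>S\<close> with a marked noncrossing part
  \<open>\<tau>\<close> avoiding \<open>a\<close>, and \<open>T\<close> is recovered as
  \<open>S - \<Union>\<tau>\<close>. For fixed \<open>\<mu>\<close> the sum over
  \<open>\<tau>\<close> is the alternating sum above, which keeps only noncrossing
  \<open>\<mu>\<close>.\<close>

lemma rooted_count_convolution:
  assumes S: "finite S" "a \<in> S"
  shows "(\<Sum>T | T \<subseteq> S \<and> a \<in> T. rooted_count a T * signed_noncrossing (S - T)) = - signed_noncrossing S"
proof -
  let ?c = "\<lambda>\<sigma> \<tau>. of_nat (card (rooted_orientations a \<sigma>)) * (-1) ^ card \<tau> :: rat"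
  let ?T = "{T. T \<subseteq> S \<and> a \<in> T}"
  let ?D = "\<lambda>T. matchings T \<times> noncrossing_matchings (S - T)"
  let ?E = "\<lambda>\<mu>. {\<tau>. \<tau> \<subseteq> \<mu> \<and> a \<notin> \<Union>\<tau> \<and> indep crosses \<tau>}"
  have finE: "finite (?E \<mu>)" if "\<mu> \<in> matchings S" for \<mu>
    by (rule finite_subset[of _ "Pow \<mu>"]) (use finite_matching[OF S(1) that] in auto)
  have finT: "finite ?T" "\<forall>T\<in>?T. finite (?D T)"
    using S finite_subset[OF _ S(1)] by (auto intro!: finite_cartesian_product)
  have join: "\<sigma> \<union> \<tau> \<in> matchings S" "\<tau> \<in> ?E (\<sigma> \<union> \<tau>)" "S - \<Union>\<tau> = T" "\<sigma> \<union> \<tau> - \<tau> = \<sigma>"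
    if T: "T \<in> ?T" and \<sigma>: "\<sigma> \<in> matchings T" and \<tau>: "\<tau> \<in> noncrossing_matchings (S - T)" for T \<sigma> \<tau>
  proof -
    have \<tau>': "\<tau> \<in> matchings (S - T)" "indep crosses \<tau>" using \<tau> by (auto simp: noncrossing_matchings_def)
    have "T \<union> (S - T) = S" using T by auto
    then show "\<sigma> \<union> \<tau> \<in> matchings S" using matchings_Un[OF \<sigma> \<tau>'(1)] by simp
    show "\<tau> \<in> ?E (\<sigma> \<union> \<tau>)" using T \<tau>'(2) matchingsD(1)[OF \<tau>'(1)] by auto
    show "S - \<Union>\<tau> = T" using T matchingsD(1)[OF \<tau>'(1)] by auto
    show "\<sigma> \<union> \<tau> - \<tau> = \<sigma>" using matchings_disjoint[OF \<sigma> \<tau>'(1)] by auto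
  qed
  have cut: "S - \<Union>\<tau> \<in> ?T" "\<mu> - \<tau> \<in> matchings (S - \<Union>\<tau>)"
      "\<tau> \<in> noncrossing_matchings (S - (S - \<Union>\<tau>))" "\<mu> - \<tau> \<union> \<tau> = \<mu>"
    if \<mu>: "\<mu> \<in> matchings S" and \<tau>: "\<tau> \<in> ?E \<mu>" for \<mu> \<tau>
  proof -
    have sub: "\<tau> \<subseteq> \<mu>" using \<tau> by auto
    show "S - \<Union>\<tau> \<in> ?T" using \<tau> S by auto
    show "\<mu> - \<tau> \<in> matchings (S - \<Union>\<tau>)"
      using matchings_subset[OF \<mu> Diff_subset[of \<mu> \<tau>]] Union_matching_Diff[OF \<mu> sub] by simp
    have "S - (S - \<Union>\<tau>) = \<Union>\<tau>" using matchingsD(1)[OF \<mu>] sub by auto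
    then show "\<tau> \<in> noncrossing_matchings (S - (S - \<Union>\<tau>))"
      using matchings_subset[OF \<mu> sub] \<tau> by (simp add: noncrossing_matchings_def)
    show "\<mu> - \<tau> \<union> \<tau> = \<mu>" using sub by auto
  qed
  have "(\<Sum>T\<in>?T. rooted_count a T * signed_noncrossing (S - T)) =
      (\<Sum>T\<in>?T. \<Sum>(\<sigma>, \<tau>)\<in>?D T. ?c \<sigma> \<tau>)"
    by (simp add: rooted_count_def signed_noncrossing_def sum_product sum.cartesian_product)
  also have "\<dots> = (\<Sum>(T, \<sigma>, \<tau>)\<in>Sigma ?T ?D. ?c \<sigma> \<tau>)"
    using sum.Sigma[OF finT, of "\<lambda>T (\<sigma>, \<tau>). ?c \<sigma> \<tau>"] by simp
  also have "\<dots> = (\<Sum>(\<mu>, \<tau>)\<in>Sigma (matchings S) ?E. ?c (\<mu> - \<tau>) \<tau>)"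
  proof (rule sum.reindex_bij_witness[of _
        "\<lambda>(\<mu>, \<tau>). (S - \<Union>\<tau>, \<mu> - \<tau>, \<tau>)" "\<lambda>(T, \<sigma>, \<tau>). (\<sigma> \<union> \<tau>, \<tau>)"], goal_cases)
    case (1 p)
    then show ?case using join(3,4) by (elim SigmaE) (simp only: prod.case)
  next
    case (2 p)
    then show ?case using join(1,2) by (elim SigmaE) (simp only: prod.case mem_Sigma_iff simp_thms)
  next
    case (3 p)
    then show ?case using cut(4) by (elim SigmaE) (simp only: prod.case)
  next
    case (4 p)
    then show ?case using cut(1-3) by (elim SigmaE) (simp only: prod.case mem_Sigma_iff simp_thms)
  next
    case (5 p)
    then show ?case using join(4) by (elim SigmaE) (simp only: prod.case)
  qed
  also have "\<dots> = (\<Sum>\<mu>\<in>matchings S. \<Sum>\<tau>\<in>?E \<mu>. ?c (\<mu> - \<tau>) \<tau>)"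
    by (rule sum.Sigma[symmetric]) (use S finE in auto)
  also have "\<dots> = (\<Sum>\<mu>\<in>matchings S. if indep crosses \<mu> then - ((-1) ^ card \<mu>) else 0)"
    by (intro sum.cong refl alternating_sum_rooted_orientations[OF S])
  also have "\<dots> = - signed_noncrossing S"
    using S by (simp add: signed_noncrossing_def noncrossing_matchings_def sum.inter_filter sum_negf[symmetric])
       (auto intro: sum.cong)
  finally show ?thesis .
qed

section \<open>Comparison with the cumulant recurrence\<close>

lemma sum_Pow_card:
  fixes g :: "nat \<Rightarrow> 'b::comm_semiring_1"
  assumes "finite A"
  shows "(\<Sum>B\<in>Pow A. g (card B)) = (\<Sum>i\<le>card A. of_nat (card A choose i) * g i)"
proof -
  have "(\<Sum>B\<in>Pow A. g (card B)) = (\<Sum>i\<le>card A. \<Sum>B | B \<in> Pow A \<and> card B = i. g (card B))"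
    by (rule sum.group[symmetric]) (use assms in \<open>auto intro: card_mono\<close>)
  also have "\<dots> = (\<Sum>i\<le>card A. of_nat (card A choose i) * g i)"
    using assms by (intro sum.cong refl) (simp add: n_subsets Pow_def)
  finally show ?thesis .
qed

text \<open>Both sides satisfy the same convolution identity with signed Catalan numbers. The term
  \<open>T = S\<close> has coefficient \<open>signed_catalan 0 = 1\<close> and every other
  \<open>T\<close> is smaller, so strong induction on the size isolates it.\<close>

lemma rooted_count_eq_ktilde0:
  assumes "finite S" "a \<in> S"
  shows "rooted_count a S = ktilde0 (card S)"
  using assms
proof (induction "card S" arbitrary: S rule: less_induct)
  case less
  note S = less(2,3)
  let ?T = "{T. T \<subseteq> S \<and> a \<in> T}"
  define m where "m = card (S - {a})"
  let ?g = "\<lambda>i. ktilde0 (Suc i) * signed_catalan (m - i)"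
  have finT: "finite ?T" using S by auto
  have cS: "card S = Suc m" using card.remove[OF S] by (simp only: m_def)
  \<comment> \<open>The sets \<open>T\<close> through \<open>a\<close> are the
    \<open>insert a U\<close> with \<open>U \<subseteq> S - {a}\<close>; grouping the
    \<open>U\<close> by size then produces the binomial coefficients of
    \<open>ktilde0_recurrence\<close>.\<close>
  have "(\<Sum>T\<in>?T. ktilde0 (card T) * signed_catalan (card (S - T))) = (\<Sum>U\<in>Pow (S - {a}). ?g (card U))"
  proof (rule sum.reindex_bij_witness[of _ "insert a" "\<lambda>T. T - {a}"])
    fix T assume T: "T \<in> ?T"
    then have "finite T" using S finite_subset by auto
    then have "card T = Suc (card (T - {a}))" using card.remove[of T a] T by blast
    moreover have "card (S - T) = card S - card T" using T \<open>finite T\<close> by (auto intro: card_Diff_subset)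
    ultimately show "?g (card (T - {a})) = ktilde0 (card T) * signed_catalan (card (S - T))"
      using cS by simp
  qed (use S in auto)
  also have "\<dots> = - signed_catalan (card S)"
    using sum_Pow_card[of "S - {a}" ?g] ktilde0_recurrence[of m] S cS
    by (simp add: m_def[symmetric] del: card_Diff_singleton card_Diff_insert)
  also have "\<dots> = (\<Sum>T\<in>?T. rooted_count a T * signed_noncrossing (S - T))"
    using rooted_count_convolution[OF S] signed_noncrossing_eq[OF S(1)] by simp
  also have "\<dots> = (\<Sum>T\<in>?T. rooted_count a T * signed_catalan (card (S - T)))"
    using S by (simp add: signed_noncrossing_eq)
  finally have eq: "(\<Sum>T\<in>?T. ktilde0 (card T) * signed_catalan (card (S - T))) =
      (\<Sum>T\<in>?T. rooted_count a T * signed_catalan (card (S - T)))" .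
  have "rooted_count a T = ktilde0 (card T)" if "T \<in> ?T - {S}" for T
    using that S by (intro less(1)) (auto intro: psubset_card_mono finite_subset)
  then have "(\<Sum>T\<in>?T - {S}. rooted_count a T * signed_catalan (card (S - T))) =
      (\<Sum>T\<in>?T - {S}. ktilde0 (card T) * signed_catalan (card (S - T)))"
    by (intro sum.cong) auto
  moreover have "signed_catalan 0 = 1" by (simp add: signed_catalan_def catalan_def)
  ultimately show ?case
    using eq S(2) sum.remove[OF finT, of S "\<lambda>T. ktilde0 (card T) * signed_catalan (card (S - T))"]
      sum.remove[OF finT, of S "\<lambda>T. rooted_count a T * signed_catalan (card (S - T))"] by simp
qed

section \<open>Crossing graphs as edge sets, and connectedness\<close>

lemma crossing_edges_iff: "{A, B} \<in> crossing_edges \<sigma> \<longleftrightarrow> A \<in> \<sigma> \<and> B \<in> \<sigma> \<and> crosses A B"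
proof
  assume "{A, B} \<in> crossing_edges \<sigma>"
  then obtain A' B' i j k l where *: "{A, B} = {A', B'}" "A' \<in> \<sigma>" "B' \<in> \<sigma>"
      "A' = {i, j}" "B' = {k, l}" "i < k" "k < j" "j < l"
    unfolding crossing_edges_def by auto
  then have "crosses A' B'" unfolding crosses_def by blast
  moreover from this have "crosses B' A'" using symp_crosses by (auto dest: sympD)
  ultimately show "A \<in> \<sigma> \<and> B \<in> \<sigma> \<and> crosses A B"
    using * by (auto simp: doubleton_eq_iff)
next
  assume *: "A \<in> \<sigma> \<and> B \<in> \<sigma> \<and> crosses A B"
  then obtain i j k l where "A = {i, j}" "B = {k, l}"
      "i < k \<and> k < j \<and> j < l \<or> k < i \<and> i < l \<and> l < j"
    unfolding crosses_def by auto
  then have "\<exists>A' B'. {A, B} = {A', B'} \<and> A' \<in> \<sigma> \<and> B' \<in> \<sigma> \<and>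
      (\<exists>i j k l. A' = {i, j} \<and> B' = {k, l} \<and> i < k \<and> k < j \<and> j < l)"
    using * insert_commute[of A B "{}"] by metis
  then show "{A, B} \<in> crossing_edges \<sigma>"
    unfolding crossing_edges_def mem_Collect_eq .
qed

lemma is_orientation_crossing_edges_iff:
  "is_orientation (crossing_edges \<sigma>) r \<and> acyclic r \<longleftrightarrow> r \<in> acyclic_orientations crosses \<sigma>"
proof -
  have "(\<forall>(u, v)\<in>r. {u, v} \<in> crossing_edges \<sigma>) \<longleftrightarrow> r \<subseteq> {(u, v). u \<in> \<sigma> \<and> v \<in> \<sigma> \<and> crosses u v}"
    by (auto simp: crossing_edges_iff)
  moreover have "(\<forall>u v. {u, v} \<in> crossing_edges \<sigma> \<longrightarrow> ((u, v) \<in> r \<longleftrightarrow> (v, u) \<notin> r)) \<longleftrightarrow>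
      (\<forall>u\<in>\<sigma>. \<forall>v\<in>\<sigma>. crosses u v \<longrightarrow> ((u, v) \<in> r \<longleftrightarrow> (v, u) \<notin> r))"
    unfolding crossing_edges_iff by metis
  ultimately show ?thesis
    unfolding is_orientation_def acyclic_orientations_def by (simp only: mem_Collect_eq conj_assoc)
qed

text \<open>Arches that fill an interval cross none of the remaining arches. For a proper interval
  both classes are nonempty, and the unique source would have to lie in each of them.\<close>

lemma matching_connected_if_rooted:
  assumes \<sigma>: "\<sigma> \<in> matchings {1..N}" and r: "r \<in> rooted_orientations a \<sigma>"
  shows "\<sigma> \<in> connected_matchings N"
proof -
  obtain A where A: "A \<in> \<sigma>" "sources \<sigma> r = {A}" and rO: "r \<in> acyclic_orientations crosses \<sigma>"
    using r by (auto simp: rooted_orientations_def)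
  have fin: "finite \<sigma>" using finite_matching[OF _ \<sigma>] by simp
  have False if ab: "x \<le> y" "{x..y} \<subset> {1..N}" and S: "S \<subseteq> \<sigma>" "\<Union>S = {x..y}" for x y S
  proof -
    have sep: "\<not> crosses B C" "\<not> crosses C B" if "B \<in> S" "C \<in> \<sigma> - S" for B C
    proof -
      have B: "B \<subseteq> {x..y}" using that S by auto
      have C: "C \<inter> {x..y} = {}" using that S Union_matching_Diff[OF \<sigma> S(1)] by auto
      show "\<not> crosses B C"
      proof
        assume "crosses B C"
        then obtain i j k l where "B = {i, j}" "C = {k, l}"
            "i < k \<and> k < j \<and> j < l \<or> k < i \<and> i < l \<and> l < j"
          unfolding crosses_def by auto
        then show False using B C by auto
      qed
      then show "\<not> crosses C B" using symp_crosses by (auto dest: sympD)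
    qed
    have "S \<noteq> {}" using S(2) ab(1) by auto
    then have "A \<in> S"
      using sep by (intro unique_source_meets_separated_set[OF fin rO A(2) S(1)]) auto
    moreover have "\<sigma> - S \<noteq> {}" using Union_matching_Diff[OF \<sigma> S(1)] S(2) ab(2) by auto
    then have "A \<in> \<sigma> - S"
      using sep by (intro unique_source_meets_separated_set[OF fin rO A(2)]) auto
    ultimately show False by simp
  qed
  then show ?thesis using \<sigma> by (auto simp: connected_matchings_def is_matching_def matchings_def)
qed

theorem theorem5p7:
  fixes n :: nat
  assumes "n \<ge> 1"
  shows "ktilde0 (2 * n) = of_nat (card {(\<sigma>, r). \<sigma> \<in> connected_matchings (2 * n) \<and>
           is_orientation (crossing_edges \<sigma>) r \<and> acyclic r \<and>
           (\<exists>A\<in>\<sigma>. 1 \<in> A \<and> sources \<sigma> r = {A})})"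
proof -
  let ?S = "{1..2 * n}"
  have "connected_matchings (2 * n) \<subseteq> matchings ?S"
    by (auto simp: connected_matchings_def is_matching_def matchings_def)
  \<comment> \<open>The right-hand side does not mention connectedness, which
    \<open>matching_connected_if_rooted\<close> restores.\<close>
  then have "{(\<sigma>, r). \<sigma> \<in> connected_matchings (2 * n) \<and>
           is_orientation (crossing_edges \<sigma>) r \<and> acyclic r \<and>
           (\<exists>A\<in>\<sigma>. 1 \<in> A \<and> sources \<sigma> r = {A})} =
        Sigma (matchings ?S) (rooted_orientations 1)"
    using matching_connected_if_rooted[of _ "2 * n" _ 1]
    unfolding rooted_orientations_def is_orientation_crossing_edges_iff[symmetric] by blast
  moreover have "of_nat (card (Sigma (matchings ?S) (rooted_orientations 1))) = rooted_count 1 ?S"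
    using finite_matching[of ?S] by (simp add: rooted_count_def)
  \<comment> \<open>Here \<open>n \<ge> 1\<close> puts the root point 1 into
    \<open>{1..2 * n}\<close>.\<close>
  moreover have "rooted_count 1 ?S = ktilde0 (2 * n)"
    using rooted_count_eq_ktilde0[of ?S 1] assms by simp
  ultimately show ?thesis by simp
qed

end
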